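(* Let $p\in\{1,\infty\}$, let $U\subseteq\mathcal{R}$ and let $\theta(\mathbf{x},t)\in\mathbb{R}^{n\times n}$ be an invertible metric function such that the generalized reduced Jacobian satisfies $\mu_p(F_r)<0$ for all $\mathbf{x}\in U$ and all $t$. Then for every $\epsilon>0$ there exist matrices $Q\in\mathbb{R}^{m\times m}$, $R\in\mathbb{R}^{m\times n}$ and an invertible $\rho\in\mathbb{R}^{m\times m}$ (possibly depending on $\mathbf{x}$ and $t$) such that the generalized unreduced Jacobian $F$ determined by $\theta,Q,R,\rho$ is contracting, i.e. $\mu_p(F)<0$, and satisfies, for all $\mathbf{x}\in U$ and all $t$, $$\mu_p(F)\le\mu_p(F_r)\,(1-\epsilon).$$
   Context: Consider the differential-algebraic (DAE) system $\dot{\mathbf{x}}=\mathbf{f}(\mathbf{x},\mathbf{y})$, $0=\mathbf{g}(\mathbf{x},\mathbf{y})$ with $\mathbf{x}\in\mathbb{R}^n$, $\mathbf{y}\in\mathbb{R}^m$, and $\mathbf{f},\mathbf{g}$ continuously differentiable with values in $\mathbb{R}^n$ and $\mathbb{R}^m$. A solution branch $\mathbf{y}=\mathbf{Y}(\mathbf{x})$ of $\mathbf{g}(\mathbf{x},\mathbf{Y}(\mathbf{x}))=0$ is fixed, and all analysis is restricted to the domain $\mathcal{R}$ of points $\mathbf{x}$ where this branch exists and $\det\left(\partial\mathbf{g}/\partial\mathbf{y}\right)|_{\mathbf{y}=\mathbf{Y}(\mathbf{x})}\neq0$. The reduced system is $\dot{\mathbf{x}}=\mathbf{f}(\mathbf{x},\mathbf{Y}(\mathbf{x}))$.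 For $\mathbf{x}\in\mathcal{R}$ put $A=\partial\mathbf{f}/\partial\mathbf{x}$, $B=\partial\mathbf{f}/\partial\mathbf{y}$, $C=\partial\mathbf{g}/\partial\mathbf{x}$, $D=\partial\mathbf{g}/\partial\mathbf{y}$, all evaluated at $(\mathbf{x},\mathbf{Y}(\mathbf{x}))$; thus $D$ is invertible. A metric function is a differentiable matrix-valued function $\theta(\mathbf{x},t)\in\mathbb{R}^{n\times n}$ with invertible values; $\dot\theta=\frac{\partial\theta}{\partial t}+\sum_{i=1}^n\frac{\partial\theta}{\partial x_i}\,f_i(\mathbf{x},\mathbf{Y}(\mathbf{x}))$ is its derivative along trajectories. The generalized reduced Jacobian is $$F_r=\dot\theta\theta^{-1}+\theta(A-BD^{-1}C)\theta^{-1}\in\mathbb{R}^{n\times n}.$$ Given auxiliary matrices $Q\in\mathbb{R}^{m\times m}$, $R\in\mathbb{R}^{m\times n}$ and an invertible metric $\rho\in\mathbb{R}^{m\times m}$ for the variable $\mathbf{y}$, the generalized unreduced Jacobian (the Jacobian of the extended system) is $$F=\begin{bmatrix}F_r+\theta R^TC\theta^{-1} & \theta R^TD\rho^{-1}\\ Q^TC\theta^{-1} & Q^TD\rho^{-1}\end{bmatrix}\in\mathbb{R}^{(n+m)\times(n+m)}.$$ For a square real matrix $M=(m_{ij})$, the matrix measure is $\mu_p(M)=\lim_{h\to0^+}\frac1h\left(\|\mathbb{1}+hM\|_p-1\right)$ with the operator norm induced by the vector $p$-norm; explicitly $\mu_1(M)=\max_j\left(m_{jj}+\sum_{i\ne j}|m_{ij}|\right)$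 and $\mu_\infty(M)=\max_i\left(m_{ii}+\sum_{j\ne i}|m_{ij}|\right)$. *)

theory Defs
  imports "HOL-Analysis.Analysis"
begin

section \<open>Matrix measures\<close>

(* Intended for 1 \<le> p \<le> \<infinity>. *)
definition pnorm :: "ereal \<Rightarrow> real ^ 'n \<Rightarrow> real" where
  "pnorm p x = (if p = \<infinity> then infnorm x
     else (\<Sum>i\<in>UNIV. \<bar>x $ i\<bar> powr real_of_ereal p) powr (1 / real_of_ereal p))"

(* At v = 0 the quotient is 0 / 0 = 0, which does not affect the supremum. *)
definition induced_norm :: "ereal \<Rightarrow> real ^ 'n ^ 'n \<Rightarrow> real" where
  "induced_norm p M = (SUP v. pnorm p (M *v v) / pnorm p v)"

definition matrix_measure :: "ereal \<Rightarrow> real ^ 'n ^ 'n \<Rightarrow> real" where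
  "matrix_measure p M = Lim (at_right 0) (\<lambda>h. (induced_norm p (mat 1 + h *\<^sub>R M) - 1) / h)"

definition block_matrix ::
  "'a ^ 'n1 ^ 'm1 \<Rightarrow> 'a ^ 'n2 ^ 'm1 \<Rightarrow> 'a ^ 'n1 ^ 'm2 \<Rightarrow> 'a ^ 'n2 ^ 'm2 \<Rightarrow> 'a ^ ('n1 + 'n2) ^ ('m1 + 'm2)" where
  "block_matrix M11 M12 M21 M22 = (\<chi> i j.
     case i of
       Inl a \<Rightarrow> (case j of Inl b \<Rightarrow> M11 $ a $ b | Inr b \<Rightarrow> M12 $ a $ b)
     | Inr a \<Rightarrow> (case j of Inl b \<Rightarrow> M21 $ a $ b | Inr b \<Rightarrow> M22 $ a $ b))"

section \<open>Differential-algebraic systems\<close>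

definition continuously_differentiable ::
  "('a::real_normed_vector \<Rightarrow> 'b::real_normed_vector) \<Rightarrow> bool" where
  "continuously_differentiable h \<longleftrightarrow>
     (\<exists>h'. (\<forall>z. (h has_derivative blinfun_apply (h' z)) (at z)) \<and> continuous_on UNIV h')"

definition jacobian_x ::
  "((real ^ 'n) \<times> (real ^ 'm) \<Rightarrow> real ^ 'k) \<Rightarrow> (real ^ 'n \<Rightarrow> real ^ 'm) \<Rightarrow> real ^ 'n \<Rightarrow> real ^ 'n ^ 'k" where
  "jacobian_x h Y x = jacobian (\<lambda>\<xi>. h (\<xi>, Y x)) (at x)"

definition jacobian_y ::
  "((real ^ 'n) \<times> (real ^ 'm) \<Rightarrow> real ^ 'k) \<Rightarrow> (real ^ 'n \<Rightarrow> real ^ 'm) \<Rightarrow> real ^ 'n \<Rightarrow> real ^ 'm ^ 'k" where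
  "jacobian_y h Y x = jacobian (\<lambda>\<eta>. h (x, \<eta>)) (at (Y x))"

(* E is the set on which the solution branch Y exists; values of Y outside E are irrelevant. *)
definition solution_branch ::
  "((real ^ 'n) \<times> (real ^ 'm) \<Rightarrow> real ^ 'm) \<Rightarrow> (real ^ 'n \<Rightarrow> real ^ 'm) \<Rightarrow> (real ^ 'n) set \<Rightarrow> bool" where
  "solution_branch g Y E \<longleftrightarrow> (\<forall>x\<in>E. g (x, Y x) = 0)"

definition regular_domain ::
  "((real ^ 'n) \<times> (real ^ 'm) \<Rightarrow> real ^ 'm) \<Rightarrow> (real ^ 'n \<Rightarrow> real ^ 'm) \<Rightarrow> (real ^ 'n) set \<Rightarrow> (real ^ 'n) set" where
  "regular_domain g Y E = {x \<in> E. det (jacobian_y g Y x) \<noteq> 0}"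

definition metric_function ::
  "(real ^ 'n) set \<Rightarrow> (real ^ 'n \<Rightarrow> real \<Rightarrow> real ^ 'n ^ 'n) \<Rightarrow> bool" where
  "metric_function S \<theta> \<longleftrightarrow>
     (\<forall>x\<in>S. \<forall>t. (\<lambda>(\<xi>, s). \<theta> \<xi> s) differentiable at (x, t) \<and> invertible (\<theta> x t))"

(* Derivative of \<theta> along trajectories of the reduced system x' = f (x, Y x). *)
definition metric_dot ::
  "((real ^ 'n) \<times> (real ^ 'm) \<Rightarrow> real ^ 'n) \<Rightarrow> (real ^ 'n \<Rightarrow> real ^ 'm) \<Rightarrow>
   (real ^ 'n \<Rightarrow> real \<Rightarrow> real ^ 'n ^ 'n) \<Rightarrow> real ^ 'n \<Rightarrow> real \<Rightarrow> real ^ 'n ^ 'n" where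
  "metric_dot f Y \<theta> x t =
     vector_derivative (\<lambda>s. \<theta> x s) (at t) +
     (\<Sum>i\<in>UNIV. (f (x, Y x) $ i) *\<^sub>R vector_derivative (\<lambda>s. \<theta> (x + s *\<^sub>R axis i 1) t) (at 0))"

definition reduced_jacobian ::
  "((real ^ 'n) \<times> (real ^ 'm) \<Rightarrow> real ^ 'n) \<Rightarrow> ((real ^ 'n) \<times> (real ^ 'm) \<Rightarrow> real ^ 'm) \<Rightarrow>
   (real ^ 'n \<Rightarrow> real ^ 'm) \<Rightarrow> (real ^ 'n \<Rightarrow> real \<Rightarrow> real ^ 'n ^ 'n) \<Rightarrow>
   real ^ 'n \<Rightarrow> real \<Rightarrow> real ^ 'n ^ 'n" where
  "reduced_jacobian f g Y \<theta> x t =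
    (let A = jacobian_x f Y x; B = jacobian_y f Y x;
         C = jacobian_x g Y x; D = jacobian_y g Y x
     in metric_dot f Y \<theta> x t ** matrix_inv (\<theta> x t) +
        \<theta> x t ** (A - B ** matrix_inv D ** C) ** matrix_inv (\<theta> x t))"

(* Q, R, rho are the values of the auxiliary matrices at the point (x, t). *)
definition unreduced_jacobian ::
  "((real ^ 'n) \<times> (real ^ 'm) \<Rightarrow> real ^ 'n) \<Rightarrow> ((real ^ 'n) \<times> (real ^ 'm) \<Rightarrow> real ^ 'm) \<Rightarrow>
   (real ^ 'n \<Rightarrow> real ^ 'm) \<Rightarrow> (real ^ 'n \<Rightarrow> real \<Rightarrow> real ^ 'n ^ 'n) \<Rightarrow>
   real ^ 'm ^ 'm \<Rightarrow> real ^ 'n ^ 'm \<Rightarrow> real ^ 'm ^ 'm \<Rightarrow>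
   real ^ 'n \<Rightarrow> real \<Rightarrow> real ^ ('n + 'm) ^ ('n + 'm)" where
  "unreduced_jacobian f g Y \<theta> Q R \<rho> x t =
    (let C = jacobian_x g Y x; D = jacobian_y g Y x;
         T = \<theta> x t; Ti = matrix_inv (\<theta> x t); \<rho>i = matrix_inv \<rho>
     in block_matrix
          (reduced_jacobian f g Y \<theta> x t + T ** transpose R ** C ** Ti)
          (T ** transpose R ** D ** \<rho>i)
          (transpose Q ** C ** Ti)
          (transpose Q ** D ** \<rho>i))"

end

theory Submission
  imports Defs
begin

text \<open>
  Take \<open>R = 0\<close>, \<open>Q\<^sup>T = -k D\<^sup>-\<^sup>1\<close> and \<open>\<rho> = (k/s) 1\<close> with \<open>k, s > 0\<close>. Then \<open>F\<close> is block lower triangular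
  with diagonal blocks \<open>F\<^sub>r\<close> and \<open>-s 1\<close> and off-diagonal block \<open>-k W\<close>, where \<open>W = D\<^sup>-\<^sup>1 C \<theta>\<^sup>-\<^sup>1\<close>. For small \<open>k\<close> the
  block \<open>-k W\<close> costs at most a fraction \<open>\<epsilon>\<close> of \<open>|\<mu>\<^sub>p(F\<^sub>r)|\<close> in the column sums, and for large \<open>s\<close> the
  rows and columns through \<open>-s 1\<close> are negligible.
\<close>

section \<open>Induced norms for \<open>p = 1\<close> and \<open>p = \<infinity>\<close>\<close>

lemma pnorm_1: "pnorm 1 x = (\<Sum>i\<in>UNIV. \<bar>x $ i\<bar>)"
  by (simp add: pnorm_def sum_nonneg)

lemma pnorm_infinity: "pnorm \<infinity> x = (MAX i. \<bar>x $ i\<bar>)"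
proof -
  have "{\<bar>x $ i\<bar> |i. i \<in> UNIV} = range (\<lambda>i. \<bar>x $ i\<bar>)" by auto
  then show ?thesis by (simp add: pnorm_def infnorm_cart cSup_eq_Max)
qed

text \<open>The supremum is a maximum: \<open>c\<close> bounds every quotient and \<open>u\<close>
  attains it. The condition \<open>0 \<le> c\<close> covers vectors with
  \<open>pnorm p v = 0\<close>, where the quotient is 0 by division by zero.\<close>

lemma induced_norm_eqI:
  assumes le: "\<And>v. pnorm p (M *v v) \<le> c * pnorm p v"
    and nonneg: "\<And>v :: real ^ 'n. 0 \<le> pnorm p v" and "0 \<le> c"
    and "pnorm p u > 0" "pnorm p (M *v u) = c * pnorm p u"
  shows "induced_norm p (M :: real ^ 'n ^ 'n) = c"
  unfolding induced_norm_def
proof (rule cSup_eq_maximum)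
  show "c \<in> range (\<lambda>v. pnorm p (M *v v) / pnorm p v)"
    using assms(4,5) by (intro range_eqI[of _ _ u]) simp
  fix y assume "y \<in> range (\<lambda>v. pnorm p (M *v v) / pnorm p v)"
  then obtain v where y: "y = pnorm p (M *v v) / pnorm p v" by auto
  show "y \<le> c"
    using le[of v] nonneg[of v] \<open>0 \<le> c\<close> by (cases "pnorm p v = 0") (auto simp: y divide_simps)
qed

text \<open>After exchanging the two sums, the norm of \<open>M *v v\<close> is bounded by the
  column sums weighted with the entries \<open>\<bar>v $ k\<bar>\<close>. The basis vector belonging
  to a largest column attains the bound.\<close>

lemma induced_norm_1:
  fixes M :: "real ^ 'n ^ 'n"
  shows "induced_norm 1 M = (MAX j. \<Sum>i\<in>UNIV. \<bar>M $ i $ j\<bar>)" (is "_ = Max (range ?c)")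
proof -
  have "Max (range ?c) \<in> range ?c" by (intro Max_in) auto
  then obtain j where j: "Max (range ?c) = ?c j" by blast
  have c_le: "?c k \<le> Max (range ?c)" for k by simp
  show ?thesis
  proof (rule induced_norm_eqI[where u = "axis j 1"])
    fix v :: "real ^ 'n"
    have "pnorm 1 (M *v v) \<le> (\<Sum>i\<in>UNIV. \<Sum>k\<in>UNIV. \<bar>M $ i $ k\<bar> * \<bar>v $ k\<bar>)"
      unfolding pnorm_1 matrix_vector_mult_def
      by (intro sum_mono) (auto intro!: order_trans[OF sum_abs] simp: abs_mult)
    also have "\<dots> = (\<Sum>k\<in>UNIV. ?c k * \<bar>v $ k\<bar>)"
      by (subst sum.swap) (simp add: sum_distrib_right)
    also have "\<dots> \<le> (\<Sum>k\<in>UNIV. Max (range ?c) * \<bar>v $ k\<bar>)"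
      by (intro sum_mono mult_right_mono c_le) simp
    finally show "pnorm 1 (M *v v) \<le> Max (range ?c) * pnorm 1 v"
      by (simp add: pnorm_1 sum_distrib_left)
    show "0 \<le> pnorm 1 v" by (simp add: pnorm_1 sum_nonneg)
  next
    have ax: "pnorm 1 (axis j 1 :: real ^ 'n) = 1"
      by (simp add: pnorm_1 axis_def if_distrib[of abs] cong: if_cong)
    then show "pnorm 1 (axis j 1 :: real ^ 'n) > 0" by simp
    show "0 \<le> Max (range ?c)" unfolding j by (intro sum_nonneg) simp
    show "pnorm 1 (M *v axis j 1) = Max (range ?c) * pnorm 1 (axis j 1 :: real ^ 'n)"
      unfolding ax j by (simp add: pnorm_1 matrix_vector_mul_component inner_axis)
  qed
qed

lemma induced_norm_infinity:
  fixes M :: "real ^ 'n ^ 'n"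
  shows "induced_norm \<infinity> M = (MAX i. \<Sum>j\<in>UNIV. \<bar>M $ i $ j\<bar>)" (is "_ = Max (range ?r)")
proof -
  have "Max (range ?r) \<in> range ?r" by (intro Max_in) auto
  then obtain i where i: "Max (range ?r) = ?r i" by blast
  have r_le: "?r k \<le> Max (range ?r)" for k by simp
  have abs_le: "\<bar>v $ k\<bar> \<le> pnorm \<infinity> v" for v :: "real ^ 'n" and k
    unfolding pnorm_infinity by simp
  have nonneg: "0 \<le> pnorm \<infinity> v" for v :: "real ^ 'n"
    using abs_le[of v] abs_ge_zero order_trans by blast
  have bound: "pnorm \<infinity> (M *v v) \<le> Max (range ?r) * pnorm \<infinity> v" for v
  proof -
    have "\<bar>(M *v v) $ k\<bar> \<le> Max (range ?r) * pnorm \<infinity> v" for k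
    proof -
      have "\<bar>(M *v v) $ k\<bar> \<le> (\<Sum>j\<in>UNIV. \<bar>M $ k $ j\<bar> * \<bar>v $ j\<bar>)"
        unfolding matrix_vector_mult_def by (auto intro!: order_trans[OF sum_abs] simp: abs_mult)
      also have "\<dots> \<le> (\<Sum>j\<in>UNIV. \<bar>M $ k $ j\<bar> * pnorm \<infinity> v)"
        by (intro sum_mono mult_left_mono abs_le) simp
      also have "\<dots> = ?r k * pnorm \<infinity> v" by (simp add: sum_distrib_right)
      also have "\<dots> \<le> Max (range ?r) * pnorm \<infinity> v"
        by (intro mult_right_mono r_le nonneg)
      finally show ?thesis .
    qed
    then show ?thesis unfolding pnorm_infinity[of "M *v v"] by simp
  qed
  \<comment> \<open>The sign pattern of the maximal row \<open>i\<close>: every product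
    \<open>M $ i $ j * u $ j\<close> is \<open>\<bar>M $ i $ j\<bar>\<close>, so nothing cancels.
    Zero entries get the value 1, so \<open>u\<close> has norm 1 even if the row vanishes.\<close>
  define u :: "real ^ 'n" where "u = (\<chi> j. if M $ i $ j < 0 then -1 else 1)"
  have u: "pnorm \<infinity> u = 1"
  proof -
    have "range (\<lambda>j. \<bar>u $ j\<bar>) = {1}" by (auto simp: u_def)
    then show ?thesis by (simp add: pnorm_infinity)
  qed
  show ?thesis
  proof (rule induced_norm_eqI[where u = u, OF bound nonneg])
    show "0 \<le> Max (range ?r)" unfolding i by (intro sum_nonneg) simp
    show "pnorm \<infinity> u > 0" by (simp add: u)
    have "(M *v u) $ i = ?r i"
      by (auto simp: matrix_vector_mult_def u_def intro!: sum.cong)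
    then have "Max (range ?r) \<le> pnorm \<infinity> (M *v u)"
      using abs_le[of "M *v u" i] i by simp
    then show "pnorm \<infinity> (M *v u) = Max (range ?r) * pnorm \<infinity> u"
      using bound[of u] by (simp only: u mult_1_right order_antisym)
  qed
qed

section \<open>Matrix measures as row and column sums\<close>

lemma tendsto_row_sum_measure:
  fixes a :: "'n::finite \<Rightarrow> 'n \<Rightarrow> real"
  shows "((\<lambda>h. ((MAX i. \<Sum>j\<in>UNIV. \<bar>(if i = j then 1 else 0) + h * a i j\<bar>) - 1) / h)
    \<longlongrightarrow> (MAX i. a i i + (\<Sum>j\<in>UNIV-{i}. \<bar>a i j\<bar>))) (at_right 0)" (is "(?q \<longlongrightarrow> Max (range ?b)) _")
proof (rule tendsto_eventually)
  define d where "d = 1 / (1 + (\<Sum>i\<in>UNIV. \<bar>a i i\<bar>))"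
  have pos: "1 + (\<Sum>i\<in>UNIV. \<bar>a i i\<bar>) > 0" by (simp add: add_pos_nonneg sum_nonneg)
  have "?q h = Max (range ?b)" if h: "h \<in> {0<..<d}" for h
  proof -
    have row: "(\<Sum>j\<in>UNIV. \<bar>(if i = j then 1 else 0) + h * a i j\<bar>) = 1 + h * ?b i" for i
    proof -
      have "\<bar>a i i\<bar> \<le> (\<Sum>i\<in>UNIV. \<bar>a i i\<bar>)" by (rule member_le_sum) auto
      then have "h * \<bar>a i i\<bar> \<le> h * (1 + (\<Sum>i\<in>UNIV. \<bar>a i i\<bar>))"
        using h by (intro mult_left_mono) auto
      also have "\<dots> \<le> 1" using h pos by (simp add: d_def field_simps)
      finally have "h * \<bar>a i i\<bar> \<le> 1" .
      moreover have "- (h * \<bar>a i i\<bar>) \<le> h * a i i"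
        using h mult_left_mono[of "- \<bar>a i i\<bar>" "a i i" h] by auto
      ultimately have "0 \<le> 1 + h * a i i" by linarith
      moreover have "(\<Sum>j\<in>UNIV-{i}. \<bar>(if i = j then 1 else 0) + h * a i j\<bar>)
          = (\<Sum>j\<in>UNIV-{i}. h * \<bar>a i j\<bar>)"
        using h by (intro sum.cong) (auto simp: abs_mult)
      ultimately show ?thesis
        by (subst sum.remove[of _ i]) (auto simp: sum_distrib_left distrib_left)
    qed
    \<comment> \<open>An increasing affine map commutes with a finite maximum, so \<open>1\<close>
      and \<open>h\<close> can be pulled out of the maximum over all rows.\<close>
    have "mono (\<lambda>y. 1 + h * y)" using h by (auto intro!: monoI mult_left_mono)
    then have "1 + h * Max (range ?b) = Max ((\<lambda>y. 1 + h * y) ` range ?b)"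
      by (rule mono_Max_commute) auto
    also have "\<dots> = (MAX i. \<Sum>j\<in>UNIV. \<bar>(if i = j then 1 else 0) + h * a i j\<bar>)"
      by (simp only: row image_image)
    finally show ?thesis using h by (simp add: field_simps)
  qed
  moreover have "0 < d" using pos by (simp add: d_def)
  ultimately show "\<forall>\<^sub>F h in at_right 0. ?q h = Max (range ?b)"
    unfolding eventually_at_right_field by (intro exI[of _ d]) simp
qed

lemma matrix_measure_1:
  "matrix_measure 1 (M :: real ^ 'n ^ 'n) = (MAX j. M $ j $ j + (\<Sum>i\<in>UNIV-{j}. \<bar>M $ i $ j\<bar>))"
proof -
  have "(mat 1 + h *\<^sub>R M) $ i $ j = (if j = i then 1 else 0) + h * M $ i $ j" for h i j
    by (simp add: mat_def)
  then show ?thesis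
    unfolding matrix_measure_def induced_norm_1
    \<comment> \<open>Column sums of \<open>M\<close> are row sums of its transpose.\<close>
    using tendsto_row_sum_measure[of "\<lambda>j i. M $ i $ j"] by (intro tendsto_Lim) simp_all
qed

lemma matrix_measure_infinity:
  "matrix_measure \<infinity> (M :: real ^ 'n ^ 'n) = (MAX i. M $ i $ i + (\<Sum>j\<in>UNIV-{i}. \<bar>M $ i $ j\<bar>))"
proof -
  have "(mat 1 + h *\<^sub>R M) $ i $ j = (if i = j then 1 else 0) + h * M $ i $ j" for h i j
    by (simp add: mat_def)
  then show ?thesis
    unfolding matrix_measure_def induced_norm_infinity
    using tendsto_row_sum_measure[of "\<lambda>i j. M $ i $ j"] by (intro tendsto_Lim) simp_all
qed

section \<open>Matrix measure of a block lower triangular matrix\<close>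

lemma sum_UNIV_Plus_minus_Inl:
  fixes h :: "'n::finite + 'm::finite \<Rightarrow> real"
  shows "sum h (UNIV - {Inl a}) = (\<Sum>i\<in>UNIV-{a}. h (Inl i)) + (\<Sum>i\<in>UNIV. h (Inr i))"
proof -
  have "UNIV - {Inl a} = Inl ` (UNIV - {a}) \<union> (Inr ` UNIV :: ('n + 'm) set)"
    by (auto simp: UNIV_sum)
  then show ?thesis by (simp only:) (subst sum.union_disjoint, auto simp: sum.reindex)
qed

lemma sum_UNIV_Plus_minus_Inr:
  fixes h :: "'n::finite + 'm::finite \<Rightarrow> real"
  shows "sum h (UNIV - {Inr b}) = (\<Sum>i\<in>UNIV. h (Inl i)) + (\<Sum>i\<in>UNIV-{b}. h (Inr i))"
proof -
  have "UNIV - {Inr b} = (Inl ` UNIV :: ('n + 'm) set) \<union> Inr ` (UNIV - {b})"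
    by (auto simp: UNIV_sum)
  then show ?thesis by (simp only:) (subst sum.union_disjoint, auto simp: sum.reindex)
qed

text \<open>The total \<open>w\<close> of the absolute entries of \<open>V\<close> dominates each of
  its row and column sums, so one pair of hypotheses serves both norms. For \<open>p = 1\<close> the
  block \<open>V\<close> adds to the columns of \<open>G\<close>, while the other columns contribute
  \<open>- s \<le> w - s\<close>. For \<open>p = \<infinity>\<close> the rows of \<open>G\<close>
  are unchanged, and the lower rows give at most \<open>w - s\<close>.\<close>

lemma matrix_measure_block_lower_le:
  fixes G :: "real ^ 'n ^ 'n" and V :: "real ^ 'n ^ 'm"
  assumes p: "p \<in> {1, \<infinity>}"
    and V: "(\<Sum>i\<in>UNIV. \<Sum>j\<in>UNIV. \<bar>V $ i $ j\<bar>) = w"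
    and \<mu>: "matrix_measure p G + w \<le> c" and s: "w - s \<le> c"
  shows "matrix_measure p (block_matrix G 0 V (mat (- s))) \<le> c"
proof -
  let ?F = "block_matrix G 0 V (mat (- s) :: real ^ 'm ^ 'm)"
  have w: "0 \<le> w" unfolding V[symmetric] by (intro sum_nonneg) simp
  have row: "(\<Sum>j\<in>UNIV. \<bar>V $ i $ j\<bar>) \<le> w" for i
    unfolding V[symmetric] by (rule member_le_sum) (auto intro: sum_nonneg)
  have col: "(\<Sum>i\<in>UNIV. \<bar>V $ i $ j\<bar>) \<le> w" for j
    unfolding V[symmetric] by (intro sum_mono member_le_sum) auto
  have D: "(\<Sum>i\<in>UNIV - {j}. \<bar>(mat (- s) :: real ^ 'm ^ 'm) $ i $ j\<bar>) = 0"
    "(\<Sum>i\<in>UNIV - {j}. \<bar>(mat (- s) :: real ^ 'm ^ 'm) $ j $ i\<bar>) = 0" for j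
    by (auto intro!: sum.neutral simp: mat_def)
  from p consider "p = 1" | "p = \<infinity>" by auto
  then show ?thesis
  proof cases
    case 1
    have G: "G $ j $ j + (\<Sum>i\<in>UNIV-{j}. \<bar>G $ i $ j\<bar>) \<le> matrix_measure p G" for j
      unfolding 1 matrix_measure_1 by simp
    have "?F $ j $ j + (\<Sum>i\<in>UNIV-{j}. \<bar>?F $ i $ j\<bar>) \<le> c" for j
    proof (cases j)
      case (Inl a)
      then show ?thesis
        using G[of a] col[of a] \<mu> by (simp add: block_matrix_def sum_UNIV_Plus_minus_Inl)
    next
      case (Inr b)
      then show ?thesis
        using D[of b] s w by (simp add: block_matrix_def sum_UNIV_Plus_minus_Inr mat_def)
    qed
    then show ?thesis unfolding 1 matrix_measure_1 by simp
  next
    case 2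
    have G: "G $ i $ i + (\<Sum>j\<in>UNIV-{i}. \<bar>G $ i $ j\<bar>) \<le> matrix_measure p G" for i
      unfolding 2 matrix_measure_infinity by simp
    have "?F $ i $ i + (\<Sum>j\<in>UNIV-{i}. \<bar>?F $ i $ j\<bar>) \<le> c" for i
    proof (cases i)
      case (Inl a)
      then show ?thesis
        using G[of a] w \<mu> by (simp add: block_matrix_def sum_UNIV_Plus_minus_Inl)
    next
      case (Inr b)
      then show ?thesis
        using D[of b] s row[of b] by (simp add: block_matrix_def sum_UNIV_Plus_minus_Inr mat_def)
    qed
    then show ?thesis unfolding 2 matrix_measure_infinity by simp
  qed
qed

section \<open>Matrix inverses and the block form of the unreduced Jacobian\<close>

lemma matrix_inv_eqI:
  fixes A B :: "real ^ 'n ^ 'n"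
  assumes "A ** B = mat 1"
  shows "invertible A" "matrix_inv A = B"
proof -
  have BA: "B ** A = mat 1" using assms by (simp add: matrix_left_right_inverse)
  with assms show "invertible A" by (auto simp: invertible_def)
  \<comment> \<open>\<open>matrix_inv\<close> is a choice among two-sided inverses. \<open>B\<close>
    shows that one exists, and uniqueness then identifies the chosen one with
    \<open>B\<close>.\<close>
  have "A ** matrix_inv A = mat 1 \<and> matrix_inv A ** A = mat 1"
    unfolding matrix_inv_def by (rule someI[of _ B]) (use assms BA in simp)
  then have "A ** matrix_inv A = mat 1" ..
  then have "B ** (A ** matrix_inv A) = B" by simp
  then show "matrix_inv A = B" by (simp add: matrix_mul_assoc BA)
qed

lemma matrix_inv_left:
  fixes A :: "real ^ 'n ^ 'n"
  assumes "invertible A"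
  shows "matrix_inv A ** A = mat 1"
  using assms matrix_inv_eqI(2) unfolding invertible_def by metis

lemma matrix_mul_mat: "A ** mat c = c *\<^sub>R (A :: real ^ 'n ^ 'm)"
  by (simp add: vec_eq_iff matrix_matrix_mult_def mat_def if_distrib cong: if_cong)

lemma matrix_mul_zero: "(0 :: real ^ 'k ^ 'n) ** A = 0" "B ** (0 :: real ^ 'k ^ 'n) = 0"
  by (simp_all add: vec_eq_iff matrix_matrix_mult_def)

lemma matrix_inv_mat:
  fixes c :: real
  assumes "c \<noteq> 0"
  shows "invertible (mat c :: real ^ 'n ^ 'n)" "matrix_inv (mat c :: real ^ 'n ^ 'n) = mat (1 / c)"
proof -
  have "(mat c :: real ^ 'n ^ 'n) ** mat (1 / c) = mat 1"
    unfolding matrix_mul_mat using assms by (simp add: vec_eq_iff mat_def)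
  then show "invertible (mat c :: real ^ 'n ^ 'n)" "matrix_inv (mat c :: real ^ 'n ^ 'n) = mat (1 / c)"
    by (fact matrix_inv_eqI)+
qed

text \<open>\<open>R = 0\<close> removes the upper right block and the correction to
  \<open>F\<^sub>r\<close>. Since \<open>\<rho>\<^sup>-\<^sup>1\<close> is \<open>s / k\<close>
  times the identity, \<open>k\<close> cancels in the lower right block: \<open>k\<close> scales
  only the coupling block and \<open>s\<close> only the diagonal one, so they can be tuned
  separately.\<close>

lemma unreduced_jacobian_block_lower:
  fixes g :: "(real ^ 'n) \<times> (real ^ 'm) \<Rightarrow> real ^ 'm"
  assumes D: "invertible (jacobian_y g Y x)" and "k > 0" "s > 0"
  shows "unreduced_jacobian f g Y \<theta> (transpose ((- k) *\<^sub>R matrix_inv (jacobian_y g Y x))) 0 (mat (k / s)) x t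
    = block_matrix (reduced_jacobian f g Y \<theta> x t) 0
        ((- k) *\<^sub>R (matrix_inv (jacobian_y g Y x) ** jacobian_x g Y x ** matrix_inv (\<theta> x t))) (mat (- s))"
proof -
  have inv: "matrix_inv (mat (k / s) :: real ^ 'm ^ 'm) = mat (s / k)"
    using assms by (simp add: matrix_inv_mat)
  have "(- k) *\<^sub>R matrix_inv (jacobian_y g Y x) ** jacobian_y g Y x ** mat (s / k)
      = (s / k) *\<^sub>R (- k) *\<^sub>R mat 1"
    unfolding matrix_mul_mat scalar_matrix_assoc[symmetric] matrix_inv_left[OF D] ..
  also have "\<dots> = mat (- s)" using assms by (simp add: vec_eq_iff mat_def)
  finally have "(- k) *\<^sub>R matrix_inv (jacobian_y g Y x) ** jacobian_y g Y x ** mat (s / k) = mat (- s)" .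
  moreover have "transpose (0 :: real ^ 'n ^ 'm) = 0" by (simp add: vec_eq_iff transpose_def)
  ultimately show ?thesis
    unfolding unreduced_jacobian_def Let_def transpose_transpose inv
    by (simp only: scalar_matrix_assoc matrix_mul_zero add_0_right)
qed

section \<open>Choice of the auxiliary matrices at a point and over \<open>U\<close>\<close>

lemma ex_contracting_unreduced_jacobian:
  fixes g :: "(real ^ 'n) \<times> (real ^ 'm) \<Rightarrow> real ^ 'm"
  assumes p: "p \<in> {1, \<infinity>}" and D: "invertible (jacobian_y g Y x)" and "\<epsilon> > 0"
    and neg: "matrix_measure p (reduced_jacobian f g Y \<theta> x t) < 0" (is "?\<mu> < 0")
  shows "\<exists>Q R \<rho>. invertible \<rho> \<and>
    matrix_measure p (unreduced_jacobian f g Y \<theta> Q R \<rho> x t) < 0 \<and>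
    matrix_measure p (unreduced_jacobian f g Y \<theta> Q R \<rho> x t) \<le> ?\<mu> * (1 - \<epsilon>)"
proof -
  define W where "W = matrix_inv (jacobian_y g Y x) ** jacobian_x g Y x ** matrix_inv (\<theta> x t)"
  define w where "w = (\<Sum>i\<in>UNIV. \<Sum>j\<in>UNIV. \<bar>W $ i $ j\<bar>)"
  \<comment> \<open>The cap 1/2 keeps \<open>1 - e\<close> positive. For
    \<open>\<epsilon> \<ge> 1\<close> the required bound is nonnegative and would not by itself give
    contraction.\<close>
  define e where "e = min \<epsilon> (1/2)"
  \<comment> \<open>Chosen so that the coupling block costs \<open>k * w \<le> - e * ?\<mu>\<close>,
    exactly the slack between \<open>?\<mu>\<close> and \<open>?\<mu> * (1 - e)\<close>. The
    denominator \<open>1 + w\<close> is nonzero even if \<open>W = 0\<close>.\<close>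
  define k where "k = - e * ?\<mu> / (1 + w)"
  \<comment> \<open>Makes \<open>k * w - s\<close> equal to \<open>?\<mu>\<close>, which lies below
    \<open>?\<mu> * (1 - e)\<close> because \<open>?\<mu>\<close> is negative.\<close>
  define s where "s = k * w - ?\<mu>"
  have e: "0 < e" "e \<le> \<epsilon>" "e \<le> 1/2" using \<open>\<epsilon> > 0\<close> by (auto simp: e_def)
  have w: "0 \<le> w" unfolding w_def by (intro sum_nonneg) simp
  have k: "0 < k" using e(1) neg w by (simp add: k_def divide_neg_pos mult_pos_neg)
  have s: "0 < s" using mult_nonneg_nonneg[of k w] k w neg unfolding s_def by linarith
  have "k * w \<le> k * (1 + w)" using k by simp
  also have "\<dots> = - e * ?\<mu>" using w by (simp add: k_def)
  finally have kw: "k * w \<le> - e * ?\<mu>" .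
  define F where "F = unreduced_jacobian f g Y \<theta>
      (transpose ((- k) *\<^sub>R matrix_inv (jacobian_y g Y x))) 0 (mat (k / s)) x t"
  have "e * ?\<mu> \<le> 0" using e(1) neg by (simp add: mult_le_0_iff)
  then have F: "matrix_measure p F \<le> ?\<mu> * (1 - e)"
    unfolding F_def unreduced_jacobian_block_lower[OF D k s] W_def[symmetric]
    using kw k by (intro matrix_measure_block_lower_le[OF p, where w = "k * w"])
      (auto simp: s_def w_def abs_mult sum_distrib_left algebra_simps)
  have "?\<mu> * (1 - e) < 0" using e neg by (simp add: mult_neg_pos)
  moreover have "?\<mu> * (1 - e) \<le> ?\<mu> * (1 - \<epsilon>)" using e neg by (intro mult_left_mono_neg) auto
  moreover have "invertible (mat (k / s) :: real ^ 'm ^ 'm)"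
    using k s by (intro matrix_inv_mat) simp
  ultimately show ?thesis using F unfolding F_def by (meson order_trans le_less_trans)
qed

theorem theorem3:
  fixes f :: "(real ^ 'n) \<times> (real ^ 'm) \<Rightarrow> real ^ 'n"
    and g :: "(real ^ 'n) \<times> (real ^ 'm) \<Rightarrow> real ^ 'm"
    and Y :: "real ^ 'n \<Rightarrow> real ^ 'm"
    and E U :: "(real ^ 'n) set"
    and \<theta> :: "real ^ 'n \<Rightarrow> real \<Rightarrow> real ^ 'n ^ 'n"
    and p :: ereal
  assumes "continuously_differentiable f"
    and "continuously_differentiable g"
    and "solution_branch g Y E"
    and "p \<in> {1, \<infinity>}"
    and "U \<subseteq> regular_domain g Y E"
    and "metric_function (regular_domain g Y E) \<theta>"
    and "\<forall>x\<in>U. \<forall>t. matrix_measure p (reduced_jacobian f g Y \<theta> x t) < 0"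
  shows "\<forall>\<epsilon>>0. \<exists>(Q :: real ^ 'n \<Rightarrow> real \<Rightarrow> real ^ 'm ^ 'm)
      (R :: real ^ 'n \<Rightarrow> real \<Rightarrow> real ^ 'n ^ 'm)
      (\<rho> :: real ^ 'n \<Rightarrow> real \<Rightarrow> real ^ 'm ^ 'm).
    \<forall>x\<in>U. \<forall>t.
      invertible (\<rho> x t) \<and>
      matrix_measure p (unreduced_jacobian f g Y \<theta> (Q x t) (R x t) (\<rho> x t) x t) < 0 \<and>
      matrix_measure p (unreduced_jacobian f g Y \<theta> (Q x t) (R x t) (\<rho> x t) x t)
        \<le> matrix_measure p (reduced_jacobian f g Y \<theta> x t) * (1 - \<epsilon>)"
proof (intro allI impI)
  fix \<epsilon> :: real assume "\<epsilon> > 0"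
  \<comment> \<open>With the membership inside the existential, witnesses exist at every
    \<open>(x, t)\<close>, so choice turns them into functions on the whole space.\<close>
  have "\<exists>Q R \<rho>. x \<in> U \<longrightarrow> invertible \<rho> \<and>
      matrix_measure p (unreduced_jacobian f g Y \<theta> Q R \<rho> x t) < 0 \<and>
      matrix_measure p (unreduced_jacobian f g Y \<theta> Q R \<rho> x t)
        \<le> matrix_measure p (reduced_jacobian f g Y \<theta> x t) * (1 - \<epsilon>)" for x t
  proof (cases "x \<in> U")
    case True
    then have "invertible (jacobian_y g Y x)"
      using assms(5) by (auto simp: regular_domain_def invertible_det_nz)
    with True show ?thesis
      using ex_contracting_unreduced_jacobian[OF assms(4) _ \<open>\<epsilon> > 0\<close>] assms(7) by blast
  qed simp
  then show "\<exists>Q R \<rho>. \<forall>x\<in>U. \<forall>t. invertible (\<rho> x t) \<and>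
      matrix_measure p (unreduced_jacobian f g Y \<theta> (Q x t) (R x t) (\<rho> x t) x t) < 0 \<and>
      matrix_measure p (unreduced_jacobian f g Y \<theta> (Q x t) (R x t) (\<rho> x t) x t)
        \<le> matrix_measure p (reduced_jacobian f g Y \<theta> x t) * (1 - \<epsilon>)"
    unfolding Ball_def by metis
qed

end
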